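(* Let $P:\subseteq\mathbb{N}^{\mathbb{N}}\rightrightarrows\mathbb{N}^{\mathbb{N}}$ be a problem and let $p\in\mathrm{dom}(P)$. The following are equivalent. 1. $p$ is a discontinuity of $P$. 2. For each $q\in P(p)$ there is a finite string $\rho\sqsubseteq q$ such that for all finite strings $\sigma\sqsubseteq p$ there is a finite string $\tau$ with $\sigma\sqsubseteq\tau\not\sqsubseteq p$ such that $P|[[\![\tau]\!]\times[\![\rho]\!]]$ is not continuous.
   Context: $\mathbb{N}^{\mathbb{N}}$ is Baire space; for finite strings and sequences, $\sigma\sqsubseteq x$ means $\sigma$ is a (not necessarily proper) initial segment of $x$, and $[\![\sigma]\!]=\{x\in\mathbb{N}^{\mathbb{N}}:\sigma\sqsubseteq x\}$. A problem $P:\subseteq\mathbb{N}^{\mathbb{N}}\rightrightarrows\mathbb{N}^{\mathbb{N}}$ is a partial multivalued function: a set $\mathrm{dom}(P)\subseteq\mathbb{N}^{\mathbb{N}}$ of instances and, for each $p\in\mathrm{dom}(P)$, a set $P(p)\subseteq\mathbb{N}^{\mathbb{N}}$ of solutions; $P(p)=\emptyset$ is allowed. $P|_A$ has domain $\mathrm{dom}(P)\cap A$ and the same solution sets. $P|[A\times B]$ has domain $\mathrm{dom}(P)\cap A$ and $P|[A\times B](x)=P(x)\cap B$ (possibly empty). $P$ is continuous if there is a continuous partial function $\Phi:\subseteq\mathbb{N}^{\mathbb{N}}\to\mathbb{N}^{\mathbb{N}}$ defined on $\mathrm{dom}(P)$ with $\Phi(p)\in P(p)$ for all $p\in\mathrm{dom}(P)$.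 A point $p\in\mathrm{dom}(P)$ is a discontinuity of $P$ if there is no open neighborhood $U$ of $p$ such that $P|_U$ is continuous. *)

theory Defs
  imports "HOL-Analysis.Function_Topology" "HOL-Library.Sublist"
begin

type_synonym baire = "nat \<Rightarrow> nat"

text \<open>
  A problem is a partial map from instances to solution sets, so an instance without solutions
  (value \<open>Some {}\<close>) is distinguished from a point outside the domain (value \<open>None\<close>).
  For \<open>p \<in> dom P\<close> the solution set is \<open>the (P p)\<close>, and the restriction of the problem to
  a set \<open>A\<close> is the library's \<open>P |` A\<close>.
\<close>

type_synonym problem = "baire \<rightharpoonup> baire set"

text \<open>
  The topology on \<^typ>\<open>baire\<close> is the product topology of the discrete topology on \<^typ>\<open>nat\<close>.
\<close>

definition initial_segment :: "nat list \<Rightarrow> baire \<Rightarrow> bool"  (infix \<open>\<sqsubseteq>\<close> 50)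
  where "\<sigma> \<sqsubseteq> x \<longleftrightarrow> (\<forall>i < length \<sigma>. \<sigma> ! i = x i)"

definition cylinder :: "nat list \<Rightarrow> baire set"
  where "cylinder \<sigma> = {x. \<sigma> \<sqsubseteq> x}"

definition restrict_both :: "problem \<Rightarrow> baire set \<Rightarrow> baire set \<Rightarrow> problem"
  where "restrict_both P A B = (\<lambda>x. map_option (\<lambda>S. S \<inter> B) ((P |` A) x))"

text \<open>
  A continuous partial function is given by its domain \<open>D\<close> and a function that is
  continuous on \<open>D\<close>.
\<close>

definition problem_continuous :: "problem \<Rightarrow> bool"
  where "problem_continuous P \<longleftrightarrow>
    (\<exists>(D :: baire set) (\<Phi> :: baire \<Rightarrow> baire).
       continuous_on D \<Phi> \<and> dom P \<subseteq> D \<and> (\<forall>p \<in> dom P. \<Phi> p \<in> the (P p)))"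

definition discontinuity :: "problem \<Rightarrow> baire \<Rightarrow> bool"
  where "discontinuity P p \<longleftrightarrow>
    p \<in> dom P \<and> \<not> (\<exists>U. open U \<and> p \<in> U \<and> problem_continuous (P |` U))"

lemma dom_restrict_both [simp]: "dom (restrict_both P A B) = dom P \<inter> A"
  by (auto simp: restrict_both_def restrict_map_def dom_def split: if_splits)

lemma the_restrict_both:
  "x \<in> dom P \<Longrightarrow> x \<in> A \<Longrightarrow> the (restrict_both P A B x) = the (P x) \<inter> B"
  by (auto simp: restrict_both_def restrict_map_def)

end

theory Submission imports Defs begin

text \<open>
  Both directions compare a candidate value \<open>q\<close> of a realizer at \<open>p\<close> with its values nearby.

  If \<open>P\<close> has a continuous realizer \<open>\<Phi>\<close> near \<open>p\<close>, take \<open>q = \<Phi> p\<close>. Given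
  \<open>\<rho> \<sqsubseteq> q\<close>, continuity at \<open>p\<close> keeps all values of \<open>\<Phi>\<close> on some cylinder
  around \<open>p\<close> inside \<open>cylinder \<rho>\<close>, so \<open>\<Phi>\<close> itself realizes every restriction
  of \<open>P\<close> to a subcylinder and to solutions extending \<open>\<rho>\<close>. This refutes the second
  condition.

  Conversely, suppose the second condition fails at \<open>q \<in> P(p)\<close>. Thus for every \<open>n\<close>
  there is \<open>k n\<close> such that \<open>P\<close>, on each cylinder that extends the first \<open>k n\<close> values of
  \<open>p\<close> but avoids \<open>p\<close>, has a continuous realizer into the solutions that agree with
  \<open>q\<close> below \<open>n\<close>. A punctured cylinder around \<open>p\<close> is the disjoint union of the
  cylinders \<open>C\<^sub>\<tau>\<close>, where \<open>\<tau>\<close> differs from \<open>p\<close> in its last entry only. A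
  realizer \<open>\<Phi>\<close> is glued from realizers on the pieces, with \<open>\<Phi> p = q\<close>: on each piece
  it is continuous since the piece is open, and it is continuous at \<open>p\<close> provided the agreement
  with \<open>q\<close> imposed on a piece tends to infinity as the pieces approach \<open>p\<close>. The latter is
  arranged by imposing on each piece the largest admissible \<open>n\<close> up to the position of the
  difference (the bound only ensures that a largest one exists).
\<close>

section \<open>Cylinders and continuity in Baire space\<close>

lemma in_cylinder_map_iff:
  "y \<in> cylinder (map x [0..<n]) \<longleftrightarrow> (\<forall>i<n. y i = x i)"
  by (auto simp: cylinder_def initial_segment_def)

lemma initial_segment_eq_map:
  "\<sigma> \<sqsubseteq> x \<longleftrightarrow> \<sigma> = map x [0..<length \<sigma>]"
  unfolding initial_segment_def list_eq_iff_nth_eq by simp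

lemma cylinder_antimono:
  assumes "prefix \<sigma> \<tau>"
  shows "cylinder \<tau> \<subseteq> cylinder \<sigma>"
proof -
  obtain \<upsilon> where "\<tau> = \<sigma> @ \<upsilon>" using assms by (rule prefixE)
  then have "\<sigma> ! i = \<tau> ! i \<and> i < length \<tau>" if "i < length \<sigma>" for i
    using that by (simp add: nth_append)
  then show ?thesis by (auto simp: cylinder_def initial_segment_def)
qed

lemma prefix_map_upt:
  assumes "k \<le> l" "\<And>i. i < k \<Longrightarrow> x i = y i"
  shows "prefix (map x [0..<k]) (map y [0..<l])"
proof -
  have "map x [0..<k] = take k (map y [0..<l])"
    using assms by (auto simp: list_eq_iff_nth_eq)
  then show ?thesis by (metis take_is_prefix)
qed

lemma open_cylinder: "open (cylinder \<sigma>)"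
proof -
  have "cylinder \<sigma> = (\<Inter>i\<in>{..<length \<sigma>}. (\<lambda>x. x i) -` {\<sigma> ! i})"
    by (auto simp: cylinder_def initial_segment_def)
  moreover have "open ((\<lambda>x::baire. x i) -` {\<sigma> ! i})" for i
    by (intro open_vimage open_discrete continuous_on_product_coordinates)
  ultimately show ?thesis by (auto intro!: open_INT)
qed

text \<open>
  A basic open set of the product topology constrains only finitely many coordinates; bounding
  their indices turns it into a cylinder.
\<close>

lemma open_contains_cylinder:
  fixes U :: "baire set"
  assumes "open U" "x \<in> U"
  obtains n where "cylinder (map x [0..<n]) \<subseteq> U"
proof -
  have "openin (product_topology (\<lambda>_. euclidean) UNIV) U"
    using assms(1) by (simp add: open_fun_def)
  from product_topology_open_contains_basis[OF this assms(2)]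
  obtain X where X: "x \<in> (\<Pi>\<^sub>E i\<in>UNIV. X i)" "finite {i. X i \<noteq> UNIV}"
      "(\<Pi>\<^sub>E i\<in>UNIV. X i) \<subseteq> U"
    by auto
  obtain n where n: "\<And>i. X i \<noteq> UNIV \<Longrightarrow> i < n"
    using X(2) finite_nat_set_iff_bounded by auto
  have "y \<in> U" if y: "\<forall>i<n. y i = x i" for y
  proof -
    have "y i \<in> X i" for i
      using X(1) n y by (cases "X i = UNIV") (auto simp: PiE_iff)
    then show ?thesis using X(3) by (auto simp: PiE_iff)
  qed
  then show ?thesis by (intro that[of n]) (auto simp: in_cylinder_map_iff)
qed

text \<open>Cylinders form a basis, so continuity may be tested on finite initial segments.\<close>

lemma continuous_on_baire_iff:
  fixes \<Phi> :: "baire \<Rightarrow> baire"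
  shows "continuous_on D \<Phi> \<longleftrightarrow>
    (\<forall>x\<in>D. \<forall>n. \<exists>m. \<forall>y\<in>D. (\<forall>i<m. y i = x i) \<longrightarrow> (\<forall>i<n. \<Phi> y i = \<Phi> x i))"
    (is "_ \<longleftrightarrow> ?R")
proof
  assume cont: "continuous_on D \<Phi>"
  show ?R
  proof (intro ballI allI)
    fix x n assume x: "x \<in> D"
    have "\<Phi> x \<in> cylinder (map (\<Phi> x) [0..<n])" by (simp add: in_cylinder_map_iff)
    from cont[unfolded continuous_on_topological, rule_format, OF x open_cylinder this]
    obtain A where A: "open A" "x \<in> A"
      "\<forall>y\<in>D. y \<in> A \<longrightarrow> \<Phi> y \<in> cylinder (map (\<Phi> x) [0..<n])"
      by blast
    obtain m where "cylinder (map x [0..<m]) \<subseteq> A"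
      using open_contains_cylinder A(1,2) by blast
    then show "\<exists>m. \<forall>y\<in>D. (\<forall>i<m. y i = x i) \<longrightarrow> (\<forall>i<n. \<Phi> y i = \<Phi> x i)"
      using A(3) by (intro exI[of _ m]) (auto simp: in_cylinder_map_iff subset_iff)
  qed
next
  assume R: ?R
  show "continuous_on D \<Phi>"
    unfolding continuous_on_topological
  proof (intro ballI allI impI)
    fix x B assume x: "x \<in> D" and B: "open B" "\<Phi> x \<in> B"
    obtain n where n: "cylinder (map (\<Phi> x) [0..<n]) \<subseteq> B"
      using open_contains_cylinder B by blast
    obtain m where m: "\<forall>y\<in>D. (\<forall>i<m. y i = x i) \<longrightarrow> (\<forall>i<n. \<Phi> y i = \<Phi> x i)"
      using R[rule_format, OF x] by blast
    show "\<exists>A. open A \<and> x \<in> A \<and> (\<forall>y\<in>D. y \<in> A \<longrightarrow> \<Phi> y \<in> B)"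
    proof (intro exI conjI)
      show "open (cylinder (map x [0..<m]))" by (rule open_cylinder)
      show "x \<in> cylinder (map x [0..<m])" by (simp add: in_cylinder_map_iff)
      show "\<forall>y\<in>D. y \<in> cylinder (map x [0..<m]) \<longrightarrow> \<Phi> y \<in> B"
        using m n by (auto simp: in_cylinder_map_iff subset_iff)
    qed
  qed
qed

section \<open>Realizers of restricted problems\<close>

lemma problem_continuous_iff:
  "problem_continuous P \<longleftrightarrow>
    (\<exists>\<Phi>. continuous_on (dom P) \<Phi> \<and> (\<forall>x\<in>dom P. \<Phi> x \<in> the (P x)))"
  unfolding problem_continuous_def using continuous_on_subset by blast

lemma problem_continuous_restrict_iff:
  "problem_continuous (P |` U) \<longleftrightarrow>
    (\<exists>\<Phi>. continuous_on (dom P \<inter> U) \<Phi> \<and> (\<forall>x\<in>dom P \<inter> U. \<Phi> x \<in> the (P x)))"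
  by (auto simp: problem_continuous_iff)

lemma problem_continuous_restrict_both_iff:
  "problem_continuous (restrict_both P A B) \<longleftrightarrow>
    (\<exists>\<Phi>. continuous_on (dom P \<inter> A) \<Phi> \<and> (\<forall>x\<in>dom P \<inter> A. \<Phi> x \<in> the (P x) \<inter> B))"
  by (simp add: problem_continuous_iff the_restrict_both)

section \<open>Continuity of a problem at a point\<close>

text \<open>
  The witness is the value at \<open>p\<close> of a realizer near \<open>p\<close>; the same realizer serves for
  all \<open>\<rho>\<close> and \<open>\<tau>\<close>, and only the length of \<open>\<sigma>\<close> depends on \<open>\<rho>\<close>.
\<close>

lemma problem_continuous_restrict_both_near:
  assumes p: "p \<in> dom P" and U: "open U" "p \<in> U" and cont: "problem_continuous (P |` U)"
  shows "\<exists>q \<in> the (P p). \<forall>\<rho>. \<rho> \<sqsubseteq> q \<longrightarrow>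
    (\<exists>\<sigma>. \<sigma> \<sqsubseteq> p \<and>
      (\<forall>\<tau>. prefix \<sigma> \<tau> \<longrightarrow> problem_continuous (restrict_both P (cylinder \<tau>) (cylinder \<rho>))))"
proof -
  obtain \<Phi> where \<Phi>: "continuous_on (dom P \<inter> U) \<Phi>" "\<forall>x\<in>dom P \<inter> U. \<Phi> x \<in> the (P x)"
    using cont by (auto simp: problem_continuous_restrict_iff)
  obtain k where k: "cylinder (map p [0..<k]) \<subseteq> U"
    using open_contains_cylinder U by blast
  show ?thesis
  proof (intro bexI[of _ "\<Phi> p"] allI impI)
    fix \<rho> assume \<rho>: "\<rho> \<sqsubseteq> \<Phi> p"
    obtain m where m: "\<forall>y\<in>dom P \<inter> U. (\<forall>i<m. y i = p i) \<longrightarrow>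
        (\<forall>i<length \<rho>. \<Phi> y i = \<Phi> p i)"
      using continuous_on_baire_iff[THEN iffD1, OF \<Phi>(1), rule_format, of p] p U(2) by blast
    define \<sigma> where "\<sigma> = map p [0..<max k m]"
    have "\<sigma> \<sqsubseteq> p" by (simp add: \<sigma>_def initial_segment_def)
    moreover have "problem_continuous (restrict_both P (cylinder \<tau>) (cylinder \<rho>))"
      if "prefix \<sigma> \<tau>" for \<tau>
    proof -
      have near: "y \<in> U \<and> (\<forall>i<m. y i = p i)" if "y \<in> cylinder \<tau>" for y
      proof -
        have "\<forall>i<max k m. y i = p i"
          using cylinder_antimono[OF \<open>prefix \<sigma> \<tau>\<close>] that
          by (auto simp: \<sigma>_def in_cylinder_map_iff simp del: less_max_iff_disj)
        then show ?thesis using k by (auto simp: in_cylinder_map_iff)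
      qed
      have "continuous_on (dom P \<inter> cylinder \<tau>) \<Phi>"
        using near by (intro continuous_on_subset[OF \<Phi>(1)]) auto
      moreover have "\<Phi> y \<in> the (P y) \<inter> cylinder \<rho>" if "y \<in> dom P \<inter> cylinder \<tau>" for y
        using near[of y] that \<Phi>(2) m \<rho> by (auto simp: cylinder_def initial_segment_def)
      ultimately show ?thesis by (auto simp: problem_continuous_restrict_both_iff)
    qed
    ultimately show "\<exists>\<sigma>. \<sigma> \<sqsubseteq> p \<and> (\<forall>\<tau>. prefix \<sigma> \<tau> \<longrightarrow>
        problem_continuous (restrict_both P (cylinder \<tau>) (cylinder \<rho>)))"
      by blast
  qed (use \<Phi>(2) p U(2) in auto)
qed

text \<open>
  The converse glues the realizers given for cylinders that avoid \<open>p\<close>. Since these realizers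
  need not be compatible, each point uses only the one for the shortest of its initial segments that
  is not an initial segment of \<open>p\<close>; this segment is locally constant away from \<open>p\<close>.
\<close>

lemma problem_continuous_near_if_restrict_both:
  assumes p: "p \<in> dom P" and q: "q \<in> the (P p)"
    and approx: "\<forall>\<rho>. \<rho> \<sqsubseteq> q \<longrightarrow> (\<exists>\<sigma>. \<sigma> \<sqsubseteq> p \<and>
      (\<forall>\<tau>. prefix \<sigma> \<tau> \<and> \<not> \<tau> \<sqsubseteq> p \<longrightarrow>
        problem_continuous (restrict_both P (cylinder \<tau>) (cylinder \<rho>))))"
  shows "\<exists>U. open U \<and> p \<in> U \<and> problem_continuous (P |` U)"
proof -
  have "\<exists>k. \<forall>\<tau>. prefix (map p [0..<k]) \<tau> \<and> \<not> \<tau> \<sqsubseteq> p \<longrightarrow>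
      problem_continuous (restrict_both P (cylinder \<tau>) (cylinder (map q [0..<n])))" for n
  proof -
    have "map q [0..<n] \<sqsubseteq> q" by (simp add: initial_segment_def)
    from approx[THEN spec, THEN mp, OF this] show ?thesis by (metis initial_segment_eq_map)
  qed
  then obtain k where k: "\<And>n \<tau>. prefix (map p [0..<k n]) \<tau> \<Longrightarrow> \<not> \<tau> \<sqsubseteq> p \<Longrightarrow>
      problem_continuous (restrict_both P (cylinder \<tau>) (cylinder (map q [0..<n])))"
    by metis

  define realizes where "realizes \<tau> n F \<longleftrightarrow> continuous_on (dom P \<inter> cylinder \<tau>) F \<and>
    (\<forall>x\<in>dom P \<inter> cylinder \<tau>. F x \<in> the (P x) \<inter> cylinder (map q [0..<n]))" for \<tau> n F
  define F where "F \<tau> n = (SOME f. realizes \<tau> n f)" for \<tau> n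
  define branch where "branch x = (LEAST i. x i \<noteq> p i)" for x
  \<comment> \<open>The set below contains \<open>0\<close> as soon as \<open>m \<ge> k 0\<close>, which holds for all branching
    points inside the cylinder \<open>U\<close>. Both bounds on \<open>n\<close> are passed eventually, so \<open>depth\<close>
    tends to infinity even if \<open>k\<close> is not monotone.\<close>
  define depth where "depth m = Max {n. n \<le> m \<and> k n \<le> m}" for m
  define \<tau> where "\<tau> x = map x [0..<Suc (branch x)]" for x
  define G where "G x = F (\<tau> x) (depth (branch x))" for x
  define \<Phi> where "\<Phi> x = (if x = p then q else G x x)" for x
  define U where "U = cylinder (map p [0..<k 0])"

  have branch_neq: "x (branch x) \<noteq> p (branch x)" if "x \<noteq> p" for x
    unfolding branch_def using that
    by (intro LeastI_ex[of "\<lambda>i. x i \<noteq> p i"]) (simp add: fun_eq_iff)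
  have branch_eq: "x i = p i" if "i < branch x" for x i
    using not_less_Least[OF that[unfolded branch_def]] by simp
  have le_branch: "m \<le> branch x" if "x \<noteq> p" "\<forall>i<m. x i = p i" for x m
    using branch_neq[OF that(1)] that(2) by (auto simp: not_less[symmetric])
  have le_depth: "n \<le> depth m" if "n \<le> m" "k n \<le> m" for n m
    unfolding depth_def using that by (intro Max_ge) auto
  have k_depth: "k (depth m) \<le> m" if "k 0 \<le> m" for m
  proof -
    have "depth m \<in> {n. n \<le> m \<and> k n \<le> m}"
      unfolding depth_def using that by (intro Max_in) auto
    then show ?thesis by simp
  qed

  have G: "realizes (\<tau> x) (depth (branch x)) (G x)" if "x \<noteq> p" "x \<in> U" for x
  proof -
    have "k 0 \<le> branch x"
      using that le_branch by (auto simp: U_def in_cylinder_map_iff)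
    then have le: "k (depth (branch x)) \<le> branch x" by (rule k_depth)
    then have "prefix (map p [0..<k (depth (branch x))]) (\<tau> x)"
      unfolding \<tau>_def by (intro prefix_map_upt) (auto simp: branch_eq)
    moreover have "\<not> \<tau> x \<sqsubseteq> p"
      using branch_neq[OF that(1)]
      by (auto simp: \<tau>_def initial_segment_def nth_append simp del: upt_Suc)
    ultimately have "\<exists>f. realizes (\<tau> x) (depth (branch x)) f"
      using k unfolding problem_continuous_restrict_both_iff realizes_def by blast
    then show ?thesis unfolding G_def F_def by (rule someI_ex)
  qed
  have in_\<tau>: "x \<in> cylinder (\<tau> x)" for x
    by (simp add: \<tau>_def in_cylinder_map_iff del: upt_Suc)
  have \<Phi>_solves: "\<Phi> x \<in> the (P x)" if "x \<in> dom P \<inter> U" for x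
    using that G[of x] in_\<tau>[of x] q by (auto simp: \<Phi>_def realizes_def)
  have same_piece: "y \<noteq> p \<and> G y = G x" if "x \<noteq> p" "\<forall>i<Suc (branch x). y i = x i" for x y
  proof -
    have "y (branch x) \<noteq> p (branch x)" using branch_neq[OF that(1)] that(2) by simp
    moreover have "y i = p i" if "i < branch x" for i
      using \<open>\<forall>i<Suc (branch x). y i = x i\<close> branch_eq[OF that] that by simp
    ultimately have "branch y = branch x"
      unfolding branch_def[of y] by (intro Least_equality) (auto simp: not_less[symmetric])
    moreover from this have "\<tau> y = \<tau> x" using that(2) by (auto simp: \<tau>_def)
    ultimately show ?thesis using \<open>y (branch x) \<noteq> p (branch x)\<close> by (auto simp: G_def)
  qed

  have "continuous_on (dom P \<inter> U) \<Phi>"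
    unfolding continuous_on_baire_iff
  proof (intro ballI allI)
    fix x n assume x: "x \<in> dom P \<inter> U"
    show "\<exists>m. \<forall>y\<in>dom P \<inter> U. (\<forall>i<m. y i = x i) \<longrightarrow> (\<forall>i<n. \<Phi> y i = \<Phi> x i)"
    proof (cases "x = p")
      case True
      have "\<forall>i<n. \<Phi> y i = q i"
        if y: "y \<in> dom P \<inter> U" and agree: "\<forall>i<max n (k n). y i = p i" for y
      proof (cases "y = p")
        case False
        have "max n (k n) \<le> branch y" using le_branch[OF False agree] .
        then have "n \<le> depth (branch y)" by (intro le_depth) auto
        moreover have "\<Phi> y \<in> cylinder (map q [0..<depth (branch y)])"
          using G[of y] False y in_\<tau>[of y] by (auto simp: \<Phi>_def realizes_def)
        ultimately show ?thesis by (auto simp: in_cylinder_map_iff)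
      qed (simp add: \<Phi>_def)
      then show ?thesis using True by (intro exI[of _ "max n (k n)"]) (simp add: \<Phi>_def)
    next
      case False
      then have cont: "continuous_on (dom P \<inter> cylinder (\<tau> x)) (G x)"
        using G x by (simp add: realizes_def)
      obtain m where m: "\<forall>y\<in>dom P \<inter> cylinder (\<tau> x). (\<forall>i<m. y i = x i) \<longrightarrow>
          (\<forall>i<n. G x y i = G x x i)"
        using continuous_on_baire_iff[THEN iffD1, OF cont, rule_format, of x] x in_\<tau>[of x]
        by blast
      have "\<forall>i<n. \<Phi> y i = \<Phi> x i"
        if y: "y \<in> dom P \<inter> U" and agree: "\<forall>i<max m (Suc (branch x)). y i = x i" for y
      proof -
        have "y \<noteq> p \<and> G y = G x" using agree by (intro same_piece[OF False]) auto
        moreover have "y \<in> cylinder (\<tau> x)"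
          using agree by (simp add: \<tau>_def in_cylinder_map_iff del: upt_Suc)
        ultimately show ?thesis using m y agree False by (auto simp: \<Phi>_def)
      qed
      then show ?thesis by blast
    qed
  qed
  with \<Phi>_solves have "problem_continuous (P |` U)"
    unfolding problem_continuous_restrict_iff by blast
  moreover have "open U" "p \<in> U"
    by (simp_all add: U_def open_cylinder in_cylinder_map_iff)
  ultimately show ?thesis by blast
qed

theorem theorem4p1p7:
  fixes P :: problem and p :: baire
  assumes "p \<in> dom P"
  shows "discontinuity P p \<longleftrightarrow>
    (\<forall>q \<in> the (P p). \<exists>\<rho>. \<rho> \<sqsubseteq> q \<and>
      (\<forall>\<sigma>. \<sigma> \<sqsubseteq> p \<longrightarrow>
        (\<exists>\<tau>. prefix \<sigma> \<tau> \<and> \<not> \<tau> \<sqsubseteq> p \<and>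
          \<not> problem_continuous (restrict_both P (cylinder \<tau>) (cylinder \<rho>)))))"
    (is "_ \<longleftrightarrow> ?R")
proof
  assume disc: "discontinuity P p"
  show ?R
  proof
    fix q assume q: "q \<in> the (P p)"
    show "\<exists>\<rho>. \<rho> \<sqsubseteq> q \<and> (\<forall>\<sigma>. \<sigma> \<sqsubseteq> p \<longrightarrow> (\<exists>\<tau>. prefix \<sigma> \<tau> \<and> \<not> \<tau> \<sqsubseteq> p \<and>
        \<not> problem_continuous (restrict_both P (cylinder \<tau>) (cylinder \<rho>))))"
      (is ?separated)
    proof (rule ccontr)
      assume contra: "\<not> ?separated"
      have "\<forall>\<rho>. \<rho> \<sqsubseteq> q \<longrightarrow> (\<exists>\<sigma>. \<sigma> \<sqsubseteq> p \<and> (\<forall>\<tau>. prefix \<sigma> \<tau> \<and> \<not> \<tau> \<sqsubseteq> p \<longrightarrow>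
          problem_continuous (restrict_both P (cylinder \<tau>) (cylinder \<rho>))))"
        using contra by (simp add: imp_conjL disj_imp)
      from problem_continuous_near_if_restrict_both[of p P q, OF assms q this] disc show False
        unfolding discontinuity_def by (elim conjE notE)
    qed
  qed
next
  assume R: ?R
  show "discontinuity P p"
    unfolding discontinuity_def
  proof (intro conjI notI assms)
    assume "\<exists>U. open U \<and> p \<in> U \<and> problem_continuous (P |` U)"
    then obtain U where "open U" "p \<in> U" "problem_continuous (P |` U)" by blast
    from problem_continuous_restrict_both_near[of p P U, OF assms this]
    obtain q where q: "q \<in> the (P p)" and near: "\<forall>\<rho>. \<rho> \<sqsubseteq> q \<longrightarrow>
        (\<exists>\<sigma>. \<sigma> \<sqsubseteq> p \<and> (\<forall>\<tau>. prefix \<sigma> \<tau> \<longrightarrow>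
          problem_continuous (restrict_both P (cylinder \<tau>) (cylinder \<rho>))))"
      by (rule bexE)
    from R[THEN bspec, OF q] obtain \<rho> where \<rho>: "\<rho> \<sqsubseteq> q" and
      bad: "\<forall>\<sigma>. \<sigma> \<sqsubseteq> p \<longrightarrow> (\<exists>\<tau>. prefix \<sigma> \<tau> \<and> \<not> \<tau> \<sqsubseteq> p \<and>
          \<not> problem_continuous (restrict_both P (cylinder \<tau>) (cylinder \<rho>)))"
      by (elim exE conjE) (rule that)
    from near[THEN spec, THEN mp, OF \<rho>] obtain \<sigma> where \<sigma>: "\<sigma> \<sqsubseteq> p" and
      good: "\<forall>\<tau>. prefix \<sigma> \<tau> \<longrightarrow>
          problem_continuous (restrict_both P (cylinder \<tau>) (cylinder \<rho>))"
      by (elim exE conjE) (rule that)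
    from bad[THEN spec, THEN mp, OF \<sigma>] good show False by auto
  qed
qed

end
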